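(* There is no upper bound, depending only on the spectral gap $G$ and the number $n$ of nonzero eigenvalues, for the smallest size of a primitive real matrix realizing an admissible nonzero spectrum; this fails already at $n=3$. That is, there is no function $f:(0,1)\to\mathbb N$ such that every admissible $3$-tuple $\Lambda$ is the nonzero spectrum of a primitive real matrix of size $N\times N$ for some $N\le f(G(\Lambda))$.
   Context: A primitive matrix is a square matrix with nonnegative real entries some positive power of which has all entries positive. If a square real matrix $A$ has characteristic polynomial $t^j\prod_{i=1}^k(t-\lambda_i)$ with all $\lambda_i\neq 0$, its nonzero spectrum is $(\lambda_1,\dots,\lambda_k)$, regarded as a multiset. For a tuple $\Lambda=(\lambda_1,\dots,\lambda_n)$ of nonzero complex numbers, put $\Lambda^k=(\lambda_1^k,\dots,\lambda_n^k)$ and $\operatorname{trace}(\Lambda^k)=\sum_i\lambda_i^k$. Call $\Lambda$ ($n\ge2$) admissible if: $\lambda_1=1$ and $|\lambda_i|<1$ for $2\le i\le n$; the polynomial $\prod_i(t-\lambda_i)$ has real coefficients; $\operatorname{trace}(\Lambda)\ge 0$; and $\operatorname{trace}(\Lambda^k)>0$ for all $k\ge 2$. The spectral gap is $G(\Lambda)=1-\max\{|\lambda_i|:2\le i\le n\}$. (A theorem of Laffey shows every admissible $\Lambda$ is the nonzero spectrum of some primitive real matrix, with an explicit bound on its size.) *)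

theory Defs
  imports "HOL-Analysis.Analysis" "Jordan_Normal_Form.Char_Poly"
begin

definition primitive_mat :: "real mat \<Rightarrow> bool" where
  "primitive_mat A \<longleftrightarrow> square_mat A \<and>
     (\<forall>i < dim_row A. \<forall>j < dim_row A. A $$ (i, j) \<ge> 0) \<and>
     (\<exists>k > 0. \<forall>i < dim_row A. \<forall>j < dim_row A. (A ^\<^sub>m k) $$ (i, j) > 0)"

definition tuple_poly :: "complex list \<Rightarrow> complex poly" where
  "tuple_poly \<Lambda> = (\<Prod>z\<leftarrow>\<Lambda>. [:- z, 1:])"

text \<open>The order of the entries of \<open>\<Lambda>\<close> is irrelevant here, so \<open>\<Lambda>\<close> is read as a multiset.\<close>

definition has_nonzero_spectrum :: "real mat \<Rightarrow> complex list \<Rightarrow> bool" where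
  "has_nonzero_spectrum A \<Lambda> \<longleftrightarrow> square_mat A \<and> 0 \<notin> set \<Lambda> \<and>
     (\<exists>j. map_poly complex_of_real (char_poly A) = monom 1 j * tuple_poly \<Lambda>)"

definition tuple_power :: "complex list \<Rightarrow> nat \<Rightarrow> complex list" where
  "tuple_power \<Lambda> k = map (\<lambda>z. z ^ k) \<Lambda>"

definition tuple_trace :: "complex list \<Rightarrow> complex" where
  "tuple_trace \<Lambda> = sum_list \<Lambda>"

text \<open>Since \<open>tuple_poly \<Lambda>\<close> has real coefficients, the traces of the powers of \<open>\<Lambda>\<close> are real,
  and their signs are expressed through \<open>Re\<close>.\<close>

definition admissible :: "complex list \<Rightarrow> bool" where
  "admissible \<Lambda> \<longleftrightarrow> length \<Lambda> \<ge> 2 \<and> 0 \<notin> set \<Lambda> \<and>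
     hd \<Lambda> = 1 \<and> (\<forall>z \<in> set (tl \<Lambda>). cmod z < 1) \<and>
     (\<forall>i. coeff (tuple_poly \<Lambda>) i \<in> \<real>) \<and>
     Re (tuple_trace \<Lambda>) \<ge> 0 \<and>
     (\<forall>k \<ge> 2. Re (tuple_trace (tuple_power \<Lambda> k)) > 0)"

definition spectral_gap :: "complex list \<Rightarrow> real" where
  "spectral_gap \<Lambda> = 1 - Max (cmod ` set (tl \<Lambda>))"

text \<open>By the next lemma, a bound that is a function of the gap on the open unit interval may be
  represented by a total function on the reals.\<close>

lemma spectral_gap_in_unit_interval:
  assumes "admissible \<Lambda>"
  shows "spectral_gap \<Lambda> \<in> {0<..<1}"
proof -
  have ne: "set (tl \<Lambda>) \<noteq> {}" and z: "0 \<notin> set (tl \<Lambda>)"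
    using assms by (cases \<Lambda>; force simp: admissible_def)+
  have "Max (cmod ` set (tl \<Lambda>)) \<in> cmod ` set (tl \<Lambda>)"
    using ne by (intro Max_in) auto
  then obtain x where x: "x \<in> set (tl \<Lambda>)" "Max (cmod ` set (tl \<Lambda>)) = cmod x"
    by auto
  then have "cmod x < 1" "x \<noteq> 0"
    using assms z by (auto simp: admissible_def)
  then show ?thesis using x by (simp add: spectral_gap_def)
qed

end

theory Submission
  imports Defs "Jordan_Normal_Form.Schur_Decomposition"
begin

text \<open>A nonnegative \<open>N \<times> N\<close> matrix satisfies \<open>(tr A)\<^sup>2 \<le> N tr(A\<^sup>2)\<close>, by Cauchy--Schwarz on the
  diagonal (the Johnson--Loewy--London inequality for the square). So it suffices to find
  admissible triples with a fixed gap, with trace bounded away from \<open>0\<close>, and with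
  \<open>trace(\<Lambda>\<^sup>2)\<close> arbitrarily small. Take \<open>\<Lambda> = (1, z, cnj z)\<close> with \<open>\<bar>z\<bar> = 3/4\<close> and \<open>Re z > 0\<close>: since
  \<open>2 (3/4)\<^sup>2 > 1\<close>, the value of \<open>trace(\<Lambda>\<^sup>2)\<close> reaches \<open>0\<close> as the argument of \<open>z\<close> varies, whereas
  \<open>2 (3/4)\<^sup>3 < 1\<close> keeps all higher power traces positive.\<close>

text \<open>Summing \<open>diag_mat\<close> fits the Schur decomposition, which delivers the
  eigenvalues as the diagonal list of the triangular factor.\<close>

definition mat_trace :: "'a :: comm_monoid_add mat \<Rightarrow> 'a" where
  "mat_trace A = sum_list (diag_mat A)"

lemma mat_trace_sum: "mat_trace A = (\<Sum>i<dim_row A. A $$ (i, i))"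
  by (simp add: mat_trace_def diag_mat_def interv_sum_list_conv_sum_set_nat atLeast0LessThan)

lemma mat_trace_comm:
  fixes A B :: "'a :: comm_semiring_0 mat"
  assumes "A \<in> carrier_mat n m" "B \<in> carrier_mat m n"
  shows "mat_trace (A * B) = mat_trace (B * A)"
proof -
  have "mat_trace (A * B) = (\<Sum>i<n. \<Sum>j<m. A $$ (i, j) * B $$ (j, i))"
    using assms by (simp add: mat_trace_sum scalar_prod_def atLeast0LessThan)
  also have "\<dots> = (\<Sum>j<m. \<Sum>i<n. B $$ (j, i) * A $$ (i, j))"
    by (subst sum.swap) (simp add: mult.commute)
  also have "\<dots> = mat_trace (B * A)"
    using assms by (simp add: mat_trace_sum scalar_prod_def atLeast0LessThan)
  finally show ?thesis .
qed

text \<open>With \<open>A = P * B * Q\<close>, cyclicity of the trace moves \<open>P\<close> to the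
  right end, where it cancels against \<open>Q\<close>.\<close>

lemma mat_trace_similar_mat_wit:
  fixes A B :: "'a :: comm_semiring_1 mat"
  assumes "A \<in> carrier_mat n n" "similar_mat_wit A B P Q"
  shows "mat_trace A = mat_trace B"
proof -
  note w = similar_mat_witD2[OF assms]
  have "mat_trace A = mat_trace (P * (B * Q))"
    using w by (simp add: assoc_mult_mat[of _ n n _ n _ n])
  also have "\<dots> = mat_trace (B * Q * P)"
    using w by (intro mat_trace_comm[of _ n n]) auto
  also have "B * Q * P = B"
    using w by (simp add: assoc_mult_mat[of _ n n _ n _ n])
  finally show ?thesis .
qed

text \<open>In the sum over \<open>j\<close> of \<open>A $$ (i, j) * B $$ (j, i)\<close>,
  triangularity of \<open>A\<close> kills the terms with \<open>j < i\<close> and that of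
  \<open>B\<close> those with \<open>i < j\<close>.\<close>

lemma upper_triangular_mult_diag:
  fixes A B :: "'a :: semiring_0 mat"
  assumes "A \<in> carrier_mat n n" "B \<in> carrier_mat n n"
    "upper_triangular A" "upper_triangular B" "i < n"
  shows "(A * B) $$ (i, i) = A $$ (i, i) * B $$ (i, i)"
proof -
  have "(A * B) $$ (i, i) = (\<Sum>j<n. A $$ (i, j) * B $$ (j, i))"
    using assms by (simp add: scalar_prod_def atLeast0LessThan)
  also have "\<dots> = (\<Sum>j\<in>{i}. A $$ (i, j) * B $$ (j, i))"
  proof (intro sum.mono_neutral_right ballI)
    fix j assume "j \<in> {..<n} - {i}"
    then have "j < i \<or> i < j" "j < n"
      by auto
    then show "A $$ (i, j) * B $$ (j, i) = 0"
      using upper_triangularD[OF assms(3), of j i] upper_triangularD[OF assms(4), of i j] assms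
      by auto
  qed (use assms in auto)
  finally show ?thesis
    by simp
qed

text \<open>Schur triangularization makes \<open>A\<close> similar to an upper triangular
  \<open>B\<close> with diagonal \<open>es\<close>. The same \<open>P\<close> and \<open>Q\<close>
  relate the squares, and squaring \<open>B\<close> squares its diagonal entries.\<close>

lemma mat_trace_eq_eigenvalues:
  fixes A :: "'a :: conjugatable_ordered_field mat"
  assumes A: "A \<in> carrier_mat n n" and "char_poly A = (\<Prod>e\<leftarrow>es. [:- e, 1:])"
  shows "mat_trace A = sum_list es" "mat_trace (A ^\<^sub>m 2) = (\<Sum>e\<leftarrow>es. e\<^sup>2)"
proof -
  obtain B P Q where "schur_decomposition A es = (B, P, Q)"
    by (metis prod_cases3)
  from schur_decomposition[OF assms this]
  have wit: "similar_mat_wit A B P Q" and ut: "upper_triangular B" and diag: "diag_mat B = es"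
    by auto
  have B: "B \<in> carrier_mat n n"
    using similar_mat_witD2[OF A wit] by simp
  show "mat_trace A = sum_list es"
    using mat_trace_similar_mat_wit[OF A wit] diag by (simp add: mat_trace_def)
  have "mat_trace (A ^\<^sub>m 2) = mat_trace (B ^\<^sub>m 2)"
    by (rule mat_trace_similar_mat_wit[OF pow_carrier_mat[OF A] similar_mat_wit_pow[OF wit]])
  also have "\<dots> = (\<Sum>i<n. (B $$ (i, i))\<^sup>2)"
    using B upper_triangular_mult_diag[OF B B ut ut]
    \<comment> \<open>Entries of the product must not unfold into scalar products, so that the rule
      for diagonal entries of triangular products can rewrite them.\<close>
    by (simp add: mat_trace_sum numeral_2_eq_2 del: index_mult_mat(1))
  also have "\<dots> = (\<Sum>e\<leftarrow>diag_mat B. e\<^sup>2)"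
    using B by (simp add: diag_mat_def o_def interv_sum_list_conv_sum_set_nat atLeast0LessThan)
  finally show "mat_trace (A ^\<^sub>m 2) = (\<Sum>e\<leftarrow>es. e\<^sup>2)"
    by (simp add: diag)
qed

text \<open>The characteristic polynomial splits over the complex numbers, so the eigenvalue
  formulas apply to the complexified matrix. Its zero eigenvalues contribute nothing to either
  trace.\<close>

lemma has_nonzero_spectrum_traces:
  assumes A: "A \<in> carrier_mat n n" and "has_nonzero_spectrum A \<Lambda>"
  shows "mat_trace A = Re (tuple_trace \<Lambda>)"
    "mat_trace (A ^\<^sub>m 2) = Re (tuple_trace (tuple_power \<Lambda> 2))"
proof -
  let ?C = "map_mat complex_of_real A"
  obtain j where j: "map_poly complex_of_real (char_poly A) = monom 1 j * tuple_poly \<Lambda>"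
    using assms by (auto simp: has_nonzero_spectrum_def)
  \<comment> \<open>The factor \<open>monom 1 j\<close> is a product of \<open>j\<close> linear
    factors with root 0, so this list is the full spectrum with multiplicity.\<close>
  have "char_poly ?C = (\<Prod>e\<leftarrow>replicate j 0 @ \<Lambda>. [:- e, 1:])"
    using of_real_hom.char_poly_hom[OF A, where 'a = complex]
    by (simp add: j tuple_poly_def monom_altdef[of 1, simplified])
  then have tr: "mat_trace ?C = sum_list (replicate j 0 @ \<Lambda>)"
      "mat_trace (?C ^\<^sub>m 2) = (\<Sum>e\<leftarrow>replicate j 0 @ \<Lambda>. e\<^sup>2)"
    using mat_trace_eq_eigenvalues[of ?C n "replicate j 0 @ \<Lambda>"] A by simp_all
  have map: "mat_trace (map_mat complex_of_real M) = of_real (mat_trace M)"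
    if "M \<in> carrier_mat n n" for M
    using that by (simp add: mat_trace_sum)
  have "complex_of_real (mat_trace A) = tuple_trace \<Lambda>"
    using tr(1) map[OF A] by (simp add: tuple_trace_def sum_list_replicate)
  then show "mat_trace A = Re (tuple_trace \<Lambda>)"
    by (metis Re_complex_of_real)
  have "complex_of_real (mat_trace (A ^\<^sub>m 2)) = tuple_trace (tuple_power \<Lambda> 2)"
    using tr(2) map[of "A ^\<^sub>m 2"] A of_real_hom.mat_hom_pow[OF A, where 'a = complex, of 2]
    by (simp add: tuple_trace_def tuple_power_def sum_list_replicate map_replicate)
  then show "mat_trace (A ^\<^sub>m 2) = Re (tuple_trace (tuple_power \<Lambda> 2))"
    by (metis Re_complex_of_real)
qed

lemma nonneg_mat_trace_power2_le:
  fixes A :: "real mat"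
  assumes A: "A \<in> carrier_mat n n"
    and nonneg: "\<And>i j. i < n \<Longrightarrow> j < n \<Longrightarrow> A $$ (i, j) \<ge> 0"
  shows "(mat_trace A)\<^sup>2 \<le> n * mat_trace (A ^\<^sub>m 2)"
proof -
  have "(mat_trace A)\<^sup>2 \<le> n * (\<Sum>i<n. (A $$ (i, i))\<^sup>2)"
    using A sum_squared_le_sum_of_squares[of "\<lambda>i. A $$ (i, i)" "{..<n}"]
    by (simp add: mat_trace_sum mult.commute)
  \<comment> \<open>Each diagonal square is the term \<open>j = i\<close> of the inner sum; the
    other terms are nonnegative.\<close>
  also have "(\<Sum>i<n. (A $$ (i, i))\<^sup>2) \<le> (\<Sum>i<n. \<Sum>j<n. A $$ (i, j) * A $$ (j, i))"
    unfolding power2_eq_square by (intro sum_mono member_le_sum) (use nonneg in auto)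
  also have "\<dots> = mat_trace (A ^\<^sub>m 2)"
    using A by (simp add: mat_trace_sum numeral_2_eq_2 scalar_prod_def atLeast0LessThan)
  finally show ?thesis
    by (simp add: mult_left_mono)
qed

lemma admissible_triple_with_small_square_trace:
  fixes \<epsilon> :: real
  assumes "0 < \<epsilon>" "\<epsilon> \<le> 1"
  obtains \<Lambda> where "admissible \<Lambda>" "length \<Lambda> = 3" "spectral_gap \<Lambda> = 1 / 4"
    "Re (tuple_trace \<Lambda>) \<ge> 1" "Re (tuple_trace (tuple_power \<Lambda> 2)) = \<epsilon>"
proof
  \<comment> \<open>These values solve \<open>x\<^sup>2 + y\<^sup>2 = 9 / 16\<close>, which fixes
    the modulus at 3/4, together with \<open>1 + 2 * (x\<^sup>2 - y\<^sup>2) = \<epsilon>\<close>,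
    the prescribed trace of the squares.\<close>
  define x where "x = sqrt (1 / 32 + \<epsilon> / 4)"
  define y where "y = sqrt (17 / 32 - \<epsilon> / 4)"
  define z where "z = Complex x y"
  define \<Lambda> where "\<Lambda> = [1, z, cnj z]"
  have x: "x > 0" "x\<^sup>2 = 1 / 32 + \<epsilon> / 4" and y: "y\<^sup>2 = 17 / 32 - \<epsilon> / 4"
    using assms by (simp_all add: x_def y_def)
  have norm_z: "cmod z = 3 / 4"
    using x y by (simp add: z_def cmod_def real_sqrt_divide)
  show "length \<Lambda> = 3" "spectral_gap \<Lambda> = 1 / 4"
    by (simp_all add: \<Lambda>_def spectral_gap_def norm_z)
  show tr1: "Re (tuple_trace \<Lambda>) \<ge> 1"
    using x by (simp add: \<Lambda>_def tuple_trace_def z_def)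
  show tr2: "Re (tuple_trace (tuple_power \<Lambda> 2)) = \<epsilon>"
    using x y by (simp add: \<Lambda>_def tuple_trace_def tuple_power_def z_def power2_eq_square)
  have tr_pos: "Re (tuple_trace (tuple_power \<Lambda> k)) > 0" if "k \<ge> 2" for k
  \<comment> \<open>The modulus bound says too little at \<open>k = 2\<close>, since 2 * (3/4)^2 =
    9/8 exceeds 1; there the exact value \<epsilon> is used. From \<open>k = 3\<close> on, twice the
    modulus is at most 27/32.\<close>
  proof (cases "k = 2")
    case True
    then show ?thesis
      using tr2 assms by simp
  next
    case False
    then have "\<bar>Re (z ^ k)\<bar> \<le> (3 / 4) ^ k"
      using abs_Re_le_cmod[of "z ^ k"] by (simp add: norm_power norm_z)
    also have "\<dots> \<le> (3 / 4) ^ 3"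
      using False that by (intro power_decreasing) auto
    finally have "2 * \<bar>Re (z ^ k)\<bar> < 1"
      by (simp add: power3_eq_cube)
    then show ?thesis
      by (simp add: \<Lambda>_def tuple_trace_def tuple_power_def flip: complex_cnj_power)
  qed
  \<comment> \<open>The conjugate pair combines into a real quadratic factor, so the coefficients
    are images of real numbers.\<close>
  have "tuple_poly \<Lambda> = map_poly complex_of_real ([:-1, 1:] * [:(cmod z)\<^sup>2, - 2 * Re z, 1:])"
  proof -
    have "of_real ((cmod z)\<^sup>2) = z * cnj z" "of_real (2 * Re z) = z + cnj z"
      by (simp_all add: complex_norm_square complex_add_cnj del: of_real_power of_real_mult)
    then show ?thesis
      by (simp add: tuple_poly_def \<Lambda>_def map_poly_pCons)
  qed
  then have "coeff (tuple_poly \<Lambda>) i \<in> \<real>" for i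
    by (simp only: coeff_map_poly of_real_0 Reals_of_real)
  moreover have "z \<noteq> 0"
    using norm_z by auto
  ultimately show "admissible \<Lambda>"
    using tr1 tr_pos by (auto simp: admissible_def \<Lambda>_def norm_z)
qed

text \<open>All triples of the family have gap 1/4, so a bound \<open>f\<close> would allow them a
  single maximal size \<open>M\<close>. The trace inequality forces
  \<open>1 \<le> N * \<epsilon>\<close> for a realization of size \<open>N\<close>, which fails for
  \<open>N \<le> M\<close> once \<open>\<epsilon> = 1 / (M + 1)\<close>.\<close>

lemma no_size_bound_at_length_3:
  "\<nexists>f :: real \<Rightarrow> nat. \<forall>\<Lambda>. admissible \<Lambda> \<and> length \<Lambda> = 3 \<longrightarrow>
     (\<exists>N \<le> f (spectral_gap \<Lambda>). \<exists>A \<in> carrier_mat N N.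
        primitive_mat A \<and> has_nonzero_spectrum A \<Lambda>)"
proof
  assume "\<exists>f :: real \<Rightarrow> nat. \<forall>\<Lambda>. admissible \<Lambda> \<and> length \<Lambda> = 3 \<longrightarrow>
     (\<exists>N \<le> f (spectral_gap \<Lambda>). \<exists>A \<in> carrier_mat N N.
        primitive_mat A \<and> has_nonzero_spectrum A \<Lambda>)"
  then obtain f :: "real \<Rightarrow> nat" where f: "\<And>\<Lambda>. admissible \<Lambda> \<Longrightarrow> length \<Lambda> = 3 \<Longrightarrow>
     (\<exists>N \<le> f (spectral_gap \<Lambda>). \<exists>A \<in> carrier_mat N N.
        primitive_mat A \<and> has_nonzero_spectrum A \<Lambda>)"
    by blast
  define M where "M = f (1 / 4)"
  obtain \<Lambda> where \<Lambda>: "admissible \<Lambda>" "length \<Lambda> = 3" "spectral_gap \<Lambda> = 1 / 4"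
    "Re (tuple_trace \<Lambda>) \<ge> 1" "Re (tuple_trace (tuple_power \<Lambda> 2)) = 1 / (M + 1)"
    by (rule admissible_triple_with_small_square_trace[of "1 / (M + 1)"]) auto
  then obtain N A where N: "N \<le> M" and A: "A \<in> carrier_mat N N" "primitive_mat A"
    "has_nonzero_spectrum A \<Lambda>"
    using f[OF \<Lambda>(1,2)] unfolding \<Lambda>(3) M_def by blast
  have "1 \<le> (Re (tuple_trace \<Lambda>))\<^sup>2"
    using \<Lambda>(4) by simp
  \<comment> \<open>Primitivity supplies the nonnegative entries, and both traces of
    \<open>A\<close> are read off from \<Lambda>.\<close>
  also have "\<dots> \<le> N * (1 / (M + 1))"
    using nonneg_mat_trace_power2_le[of A N] A
    by (simp add: has_nonzero_spectrum_traces[OF A(1,3)] \<Lambda>(5) primitive_mat_def)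
  also have "\<dots> < 1"
    using N by simp
  finally show False
    by simp
qed

theorem proposition4p12p12:
  shows "(\<nexists>f :: real \<Rightarrow> nat \<Rightarrow> nat. \<forall>\<Lambda>. admissible \<Lambda> \<longrightarrow>
            (\<exists>N \<le> f (spectral_gap \<Lambda>) (length \<Lambda>). \<exists>A \<in> carrier_mat N N.
               primitive_mat A \<and> has_nonzero_spectrum A \<Lambda>)) \<and>
         (\<nexists>f :: real \<Rightarrow> nat. \<forall>\<Lambda>. admissible \<Lambda> \<and> length \<Lambda> = 3 \<longrightarrow>
            (\<exists>N \<le> f (spectral_gap \<Lambda>). \<exists>A \<in> carrier_mat N N.
               primitive_mat A \<and> has_nonzero_spectrum A \<Lambda>))"
proof (rule conjI)
  show "\<nexists>f :: real \<Rightarrow> nat \<Rightarrow> nat. \<forall>\<Lambda>. admissible \<Lambda> \<longrightarrow>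
            (\<exists>N \<le> f (spectral_gap \<Lambda>) (length \<Lambda>). \<exists>A \<in> carrier_mat N N.
               primitive_mat A \<and> has_nonzero_spectrum A \<Lambda>)"
  proof
    assume "\<exists>f :: real \<Rightarrow> nat \<Rightarrow> nat. \<forall>\<Lambda>. admissible \<Lambda> \<longrightarrow>
            (\<exists>N \<le> f (spectral_gap \<Lambda>) (length \<Lambda>). \<exists>A \<in> carrier_mat N N.
               primitive_mat A \<and> has_nonzero_spectrum A \<Lambda>)"
    then obtain f :: "real \<Rightarrow> nat \<Rightarrow> nat" where f: "\<forall>\<Lambda>. admissible \<Lambda> \<longrightarrow>
            (\<exists>N \<le> f (spectral_gap \<Lambda>) (length \<Lambda>). \<exists>A \<in> carrier_mat N N.
               primitive_mat A \<and> has_nonzero_spectrum A \<Lambda>)"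
      by blast
    \<comment> \<open>Fixing the length argument of \<open>f\<close> at 3 would give a bound for
      triples in terms of the gap.\<close>
    have "\<exists>g :: real \<Rightarrow> nat. \<forall>\<Lambda>. admissible \<Lambda> \<and> length \<Lambda> = 3 \<longrightarrow>
            (\<exists>N \<le> g (spectral_gap \<Lambda>). \<exists>A \<in> carrier_mat N N.
               primitive_mat A \<and> has_nonzero_spectrum A \<Lambda>)"
      using f by (intro exI[of _ "\<lambda>x. f x 3"]) metis
    with no_size_bound_at_length_3 show False
      by (rule notE)
  qed
qed (rule no_size_bound_at_length_3)

end
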